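(* Consider the one-dimensional hierarchical model \[ Y\mid\beta \sim \mathrm{N}(\beta,1),\qquad \nu(\beta\mid \gamma,\lambda,\alpha)=\frac{\alpha\,\gamma^{1/\alpha}}{2^{1/\alpha+1}\Gamma(1/\alpha)}\,\lambda^{1/\alpha}\exp\Big\{-\frac{\gamma}{2}\lambda|\beta|^{\alpha}\Big\}, \] \[ \lambda\mid\kappa \sim (1-\kappa)\,\mathrm{Gamma}(\lambda;e_1,f_1)+\kappa\,\mathrm{Gamma}(\lambda;e_2,f_2),\qquad \alpha\sim\mathrm{Unif}(k_1,k_2),\qquad \kappa\sim\mathrm{Bern}(1/2), \] with hyperparameters $e_1,f_1,e_2,f_2>0$, $0<k_1\le 1$, $2\le k_2$, and $\gamma>0$ fixed. Let $m(y)$ be the marginal density of $Y$ obtained by integrating out $\beta,\lambda,\alpha,\kappa$, so that the posterior mean satisfies $E(\beta\mid y)=y+\frac{d}{dy}\log m(y)$. Then there is a constant $C_h$ depending only on the hyperparameters such that $|y-E(\beta\mid y)|\le C_h$ for all $y$, and \[ \lim_{|y|\to\infty}\frac{d}{dy}\log m(y)=0 . \]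
   Context: $\mathrm{Gamma}(\lambda;e,f)$ denotes the Gamma density with shape $e$ and rate $f$ evaluated at $\lambda$; $\mathrm{Unif}(k_1,k_2)$ is the uniform distribution on $[k_1,k_2]$; $\mathrm{Bern}(1/2)$ is the Bernoulli distribution with success probability $1/2$. The prior for $\beta$ given $(\gamma,\lambda,\alpha)$ is a generalized Gaussian (exponential power) density. *)

theory Defs
  imports "HOL-Analysis.Analysis"
begin

definition normal1_density :: "real \<Rightarrow> real \<Rightarrow> real" where
  "normal1_density b y = exp (- ((y - b)\<^sup>2) / 2) / sqrt (2 * pi)"

definition gamma_density :: "real \<Rightarrow> real \<Rightarrow> real \<Rightarrow> real" where
  "gamma_density l e f = (if l > 0 then f powr e * l powr (e - 1) * exp (- f * l) / Gamma e else 0)"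

definition gg_prior :: "real \<Rightarrow> real \<Rightarrow> real \<Rightarrow> real \<Rightarrow> real" where
  "gg_prior gam l a b =
     a * gam powr (1 / a) / (2 powr (1 / a + 1) * Gamma (1 / a)) * l powr (1 / a)
       * exp (- (gam / 2) * l * \<bar>b\<bar> powr a)"

definition lambda_prior :: "real \<Rightarrow> real \<Rightarrow> real \<Rightarrow> real \<Rightarrow> real \<Rightarrow> real \<Rightarrow> real" where
  "lambda_prior e1 f1 e2 f2 \<kappa> l = (1 - \<kappa>) * gamma_density l e1 f1 + \<kappa> * gamma_density l e2 f2"

text \<open>Integral of g(beta) * p(y|beta) * prior over beta, lambda, alpha, kappa
  (alpha ~ Unif(k1,k2), kappa ~ Bern(1/2)).\<close>
definition hier_integral ::
  "(real \<Rightarrow> real) \<Rightarrow> real \<Rightarrow> real \<Rightarrow> real \<Rightarrow> real \<Rightarrow> real \<Rightarrow> real \<Rightarrow> real \<Rightarrow> real \<Rightarrow> real" where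
  "hier_integral g e1 f1 e2 f2 k1 k2 gam y =
     (LINT a:{k1..k2}|lborel. (1 / (k2 - k1)) *
        (\<Sum>\<kappa>\<in>{0::real, 1}. (1 / 2) *
           (LINT l:{0<..}|lborel. lambda_prior e1 f1 e2 f2 \<kappa> l *
              (LINT b|lborel. g b * normal1_density b y * gg_prior gam l a b))))"

definition marginal :: "real \<Rightarrow> real \<Rightarrow> real \<Rightarrow> real \<Rightarrow> real \<Rightarrow> real \<Rightarrow> real \<Rightarrow> real \<Rightarrow> real" where
  "marginal e1 f1 e2 f2 k1 k2 gam y = hier_integral (\<lambda>_. 1) e1 f1 e2 f2 k1 k2 gam y"

definition post_mean :: "real \<Rightarrow> real \<Rightarrow> real \<Rightarrow> real \<Rightarrow> real \<Rightarrow> real \<Rightarrow> real \<Rightarrow> real \<Rightarrow> real" where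
  "post_mean e1 f1 e2 f2 k1 k2 gam y =
     hier_integral (\<lambda>b. b) e1 f1 e2 f2 k1 k2 gam y / marginal e1 f1 e2 f2 k1 k2 gam y"

end

theory Submission
  imports Defs "HOL-Probability.Distributions"
begin

text \<open>
  Integrating out \<open>\<lambda>\<close> turns the exponential-power prior with a Gamma scale into the polynomially
  decaying density proportional to \<open>(f + (\<gamma>/2) \<bar>\<beta>\<bar>\<^sup>\<alpha>)\<close> raised to \<open>-(e + 1/\<alpha>)\<close>. Such a density \<open>p\<close>
  is almost constant far out: the ratio \<open>p (x + h) / p x\<close> is at most exponential in \<open>\<bar>h\<bar>\<close> for all
  \<open>x\<close>, and it differs from 1 by at most \<open>1/\<bar>x\<bar>\<close> times such a quantity when \<open>\<bar>x\<bar> \<ge> 1\<close>, uniformly in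
  \<open>\<alpha>\<close>. Both bounds are linear in \<open>p\<close>, so they survive integration over \<open>\<alpha>\<close> and \<open>\<kappa>\<close>.
  The marginal of \<open>Y\<close> is then the convolution \<open>m\<close> of the standard normal density \<open>\<phi>\<close> with the marginal
  prior \<open>p\<close>, and \<open>m' y\<close> is the integral of \<open>z \<phi>(z) p (y + z)\<close>. The first bound gives
  \<open>\<bar>m' y\<bar> = O(p y) = O(m y)\<close>. As \<open>z \<phi>(z)\<close> integrates to 0, \<open>p (y + z)\<close> may be replaced by
  \<open>p (y + z) - p y\<close>, and the second bound gives \<open>\<bar>m' y\<bar> = O(m y / \<bar>y\<bar>)\<close>.
\<close>

section \<open>Exponential moments and a quantitative Taylor bound for the Gaussian density\<close>

lemma normal1_density_eq: "normal1_density b y = std_normal_density (y - b)"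
  by (simp add: normal1_density_def std_normal_density_def)

lemma std_normal_density_minus: "std_normal_density (- x) = std_normal_density x"
  by (simp add: std_normal_density_def)

lemma std_normal_density_shift:
  "std_normal_density (x + h) = std_normal_density x * exp (- x * h - h\<^sup>2 / 2)"
  by (simp add: std_normal_density_def power2_sum exp_add [symmetric] field_simps)

text \<open>Completing the square turns \<open>std_normal_density x * exp (S * x)\<close> into a
  multiple of the normal density with mean \<open>S\<close>, and
  \<open>exp (S * \<bar>x\<bar>)\<close> is one of \<open>exp (S * x)\<close> and
  \<open>exp (- S * x)\<close>. The growth bound on \<open>p\<close> reduces the convolution
  integrals to this one.\<close>

lemma integrable_std_normal_exp_abs:
  "integrable lborel (\<lambda>x. std_normal_density x * exp (S * \<bar>x\<bar>))"
proof (rule Bochner_Integration.integrable_bound)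
  show "integrable lborel (\<lambda>x. exp (S\<^sup>2 / 2) * (normal_density S 1 x + normal_density (- S) 1 x))"
    by simp
  have "std_normal_density x * exp (S * x) = exp (S\<^sup>2 / 2) * normal_density S 1 x" for S x :: real
    by (simp add: normal_density_def exp_add [symmetric] power2_eq_square field_simps)
  from this[of _ S] this[of _ "- S"]
  have "std_normal_density x * exp (S * \<bar>x\<bar>)
      \<le> exp (S\<^sup>2 / 2) * (normal_density S 1 x + normal_density (- S) 1 x)" for x
    by (cases "x \<ge> 0") (simp_all add: distrib_left)
  then show "AE x in lborel. norm (std_normal_density x * exp (S * \<bar>x\<bar>))
      \<le> norm (exp (S\<^sup>2 / 2) * (normal_density S 1 x + normal_density (- S) 1 x))"
    by (simp add: abs_mult)
qed simp

lemma abs_le_exp: "\<bar>x::real\<bar> \<le> exp \<bar>x\<bar>"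
  using exp_ge_add_one_self[of "\<bar>x\<bar>"] by linarith

lemma exp_minus_one_le: "exp v - 1 \<le> v * exp v" for v :: real
  using exp_ge_add_one_self[of "- v"] mult_left_mono[of "1 - v" "exp (- v)" "exp v"]
  by (simp add: algebra_simps exp_minus_inverse)

text \<open>Convexity makes the remainder nonnegative. By \<open>exp u - 1 \<le> u * exp u\<close>
  it is at most \<open>u * (exp u - 1)\<close>, whose second factor is again at most
  \<open>\<bar>u\<bar> * exp \<bar>u\<bar>\<close> in absolute value.\<close>

lemma exp_remainder_bound: "\<bar>exp u - 1 - u\<bar> \<le> u\<^sup>2 * exp \<bar>u\<bar>" for u :: real
proof -
  have ge: "0 \<le> exp u - 1 - u" using exp_ge_add_one_self[of u] by linarith
  have "exp u - 1 - u \<le> u * (exp u - 1)" using exp_minus_one_le[of u] by (simp add: algebra_simps)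
  also have "\<dots> \<le> u * (u * exp \<bar>u\<bar>)"
  proof (cases "u \<ge> 0")
    case True
    then show ?thesis using exp_minus_one_le[of u] by (intro mult_left_mono) auto
  next
    case False
    have "u * exp \<bar>u\<bar> \<le> u * 1" using False by (intro mult_left_mono_neg) auto
    also have "u * 1 \<le> exp u - 1" using ge by simp
    finally show ?thesis using False by (intro mult_left_mono_neg) auto
  qed
  finally show ?thesis using ge by (simp add: power2_eq_square)
qed

text \<open>Differentiation of the convolution under the integral rests on this bound. The shift by
  \<open>h\<close> multiplies the density by \<open>exp u\<close> with
  \<open>u = - x * h - h\<^sup>2 / 2\<close>, so the expression is the density times the exponential
  remainder at \<open>u\<close>, less \<open>h\<^sup>2 / 2\<close>. The exponent 3 arises from
  \<open>u\<^sup>2 \<le> h\<^sup>2 * exp (2 * \<bar>x\<bar>)\<close> and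
  \<open>\<bar>u\<bar> \<le> \<bar>x\<bar> + 1\<close>; the 4 is the bound 3 for
  \<open>exp 1\<close> plus 1 for the term \<open>h\<^sup>2 / 2\<close>.\<close>

lemma std_normal_density_taylor:
  assumes "\<bar>h\<bar> \<le> 1"
  shows "\<bar>std_normal_density (x + h) - std_normal_density x + h * x * std_normal_density x\<bar>
    \<le> 4 * h\<^sup>2 * (std_normal_density x * exp (3 * \<bar>x\<bar>))"
proof -
  define u where "u = - x * h - h\<^sup>2 / 2"
  have h2: "h\<^sup>2 \<le> \<bar>h\<bar>" using assms abs_square_le_1[of h] by (metis abs_ge_zero abs_mult_self_eq mult_left_le power2_eq_square)
  have "\<bar>u\<bar> \<le> \<bar>x * h\<bar> + h\<^sup>2 / 2"
    unfolding u_def by (rule order_trans[OF abs_triangle_ineq4]) simp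
  also have "\<dots> \<le> \<bar>h\<bar> * (\<bar>x\<bar> + 1 / 2)" using h2 by (simp add: abs_mult algebra_simps)
  finally have u: "\<bar>u\<bar> \<le> \<bar>h\<bar> * (\<bar>x\<bar> + 1 / 2)" .
  also have "\<dots> \<le> 1 * (\<bar>x\<bar> + 1 / 2)" using assms by (intro mult_right_mono) auto
  finally have u1: "\<bar>u\<bar> \<le> \<bar>x\<bar> + 1" by simp
  have "\<bar>h\<bar> * (\<bar>x\<bar> + 1 / 2) \<le> \<bar>h\<bar> * exp \<bar>x\<bar>"
    using exp_ge_add_one_self[of "\<bar>x\<bar>"] by (intro mult_left_mono, linarith) simp
  with u have "\<bar>u\<bar> \<le> \<bar>h\<bar> * exp \<bar>x\<bar>" by linarith
  then have "\<bar>u\<bar>\<^sup>2 \<le> (\<bar>h\<bar> * exp \<bar>x\<bar>)\<^sup>2" by (intro power_mono) auto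
  also have "\<dots> = h\<^sup>2 * exp (2 * \<bar>x\<bar>)" by (simp add: power_mult_distrib exp_double)
  finally have u2: "u\<^sup>2 \<le> h\<^sup>2 * exp (2 * \<bar>x\<bar>)" by simp
  have "\<bar>exp u - 1 + h * x\<bar> = \<bar>(exp u - 1 - u) - h\<^sup>2 / 2\<bar>" by (simp add: u_def mult.commute)
  also have "\<dots> \<le> u\<^sup>2 * exp \<bar>u\<bar> + h\<^sup>2 / 2" using exp_remainder_bound[of u] zero_le_power2[of h]
    by linarith
  also have "u\<^sup>2 * exp \<bar>u\<bar> \<le> (h\<^sup>2 * exp (2 * \<bar>x\<bar>)) * exp (\<bar>x\<bar> + 1)"
    using u1 u2 by (intro mult_mono) auto
  also have "\<dots> = h\<^sup>2 * exp (3 * \<bar>x\<bar>) * exp 1" by (simp add: exp_add [symmetric] mult.assoc)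
  also have "\<dots> \<le> h\<^sup>2 * exp (3 * \<bar>x\<bar>) * 3" using exp_le by (intro mult_left_mono) auto
  also have "h\<^sup>2 / 2 \<le> h\<^sup>2 * exp (3 * \<bar>x\<bar>)"
    using mult_mono[of "1 / 2" "exp (3 * \<bar>x\<bar>)" "h\<^sup>2" "h\<^sup>2"] one_le_exp_iff[of "3 * \<bar>x\<bar>"]
    by (simp add: mult.commute del: one_le_exp_iff)
  finally have "\<bar>exp u - 1 + h * x\<bar> \<le> 4 * h\<^sup>2 * exp (3 * \<bar>x\<bar>)" by simp
  then have "std_normal_density x * \<bar>exp u - 1 + h * x\<bar>
      \<le> std_normal_density x * (4 * h\<^sup>2 * exp (3 * \<bar>x\<bar>))"
    by (intro mult_left_mono) auto
  moreover have "std_normal_density (x + h) - std_normal_density x + h * x * std_normal_density x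
      = std_normal_density x * (exp u - 1 + h * x)"
    by (simp only: std_normal_density_shift [of x h] u_def) (simp add: algebra_simps)
  ultimately show ?thesis by (simp add: abs_mult mult_ac)
qed

section \<open>Gaussian convolution of a density with flat tails\<close>

definition flat_bounds :: "(real \<Rightarrow> real) \<Rightarrow> real \<Rightarrow> real \<Rightarrow> real \<Rightarrow> bool" where
  "flat_bounds q B S W \<longleftrightarrow>
     (\<forall>x h. q (x + h) \<le> B * exp (S * \<bar>h\<bar>) * q x) \<and>
     (\<forall>x h. \<bar>x\<bar> \<ge> 1 \<longrightarrow> \<bar>q (x + h) - q x\<bar> \<le> W * \<bar>h\<bar> * exp (S * \<bar>h\<bar>) / \<bar>x\<bar> * q x)"

text \<open>Abstracts the marginal prior. Flatness stays a predicate outside the locale because it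
  is proved first for the mixture components and then carried over to the mixture that becomes
  \<open>p\<close>.\<close>

locale flat_tailed =
  fixes p :: "real \<Rightarrow> real" and B S W :: real
  assumes p_measurable [measurable]: "p \<in> borel_measurable borel"
    and p_pos: "p x > 0"
    and p_flat_bounds: "flat_bounds p B S W"
begin

lemma p_growth: "p (x + h) \<le> B * exp (S * \<bar>h\<bar>) * p x"
  using p_flat_bounds unfolding flat_bounds_def by blast

lemma p_flat: "\<bar>x\<bar> \<ge> 1 \<Longrightarrow> \<bar>p (x + h) - p x\<bar> \<le> W * \<bar>h\<bar> * exp (S * \<bar>h\<bar>) / \<bar>x\<bar> * p x"
  using p_flat_bounds unfolding flat_bounds_def by blast


definition conv :: "real \<Rightarrow> real" where
  "conv y = (LINT b|lborel. std_normal_density (y - b) * p b)"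

text \<open>The integrand of \<open>conv\<close> differentiated in \<open>y\<close>, since the
  standard normal density has derivative \<open>- z\<close> times itself. With \<open>p\<close> the
  prior, \<open>conv_deriv y / conv y\<close> is the posterior mean minus \<open>y\<close>.\<close>

definition conv_deriv :: "real \<Rightarrow> real" where
  "conv_deriv y = (LINT b|lborel. (b - y) * std_normal_density (y - b) * p b)"

lemma B_pos: "B > 0"
  using p_growth[of 0 0] p_pos[of 0] by (simp add: zero_less_mult_iff mult_le_cancel_right2 less_le_trans)

text \<open>Substituting \<open>b = y + z\<close>, the growth bound based at \<open>y\<close>
  replaces \<open>p (y + z)\<close> by a constant times \<open>exp (S * \<bar>z\<bar>)\<close>. The
  rate \<open>k\<close> is 0 for \<open>conv\<close>, 1 for \<open>conv_deriv\<close> and 3 for the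
  Taylor remainder.\<close>

lemma integrable_gauss_exp_p:
  "integrable lborel (\<lambda>b. std_normal_density (y - b) * exp (k * \<bar>y - b\<bar>) * p b)"
proof -
  have "integrable lborel (\<lambda>z. std_normal_density z * exp (k * \<bar>z\<bar>) * p (y + z))"
  proof (rule Bochner_Integration.integrable_bound)
    show "integrable lborel (\<lambda>z. B * p y * (std_normal_density z * exp ((k + S) * \<bar>z\<bar>)))"
      by (intro integrable_mult_right integrable_std_normal_exp_abs)
    have "std_normal_density z * exp (k * \<bar>z\<bar>) * p (y + z)
        \<le> B * p y * (std_normal_density z * exp ((k + S) * \<bar>z\<bar>))" for z
      using mult_left_mono[OF p_growth[of y z], of "std_normal_density z * exp (k * \<bar>z\<bar>)"]
      by (simp add: algebra_simps exp_add)
    then show "AE z in lborel. norm (std_normal_density z * exp (k * \<bar>z\<bar>) * p (y + z))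
        \<le> norm (B * p y * (std_normal_density z * exp ((k + S) * \<bar>z\<bar>)))"
      using p_pos B_pos by (simp add: abs_mult less_imp_le)
  qed simp
  from lborel_integrable_real_affine[OF this, of 1 "- y"]
  show ?thesis by (simp add: std_normal_density_minus[of "y - _", symmetric] abs_minus_commute)
qed

lemma integrable_conv: "integrable lborel (\<lambda>b. std_normal_density (y - b) * p b)"
  using integrable_gauss_exp_p[of y 0] by simp

lemma integrable_conv_deriv:
  "integrable lborel (\<lambda>b. (b - y) * std_normal_density (y - b) * p b)"
proof (rule Bochner_Integration.integrable_bound[OF integrable_gauss_exp_p[of y 1]])
  show "AE b in lborel. norm ((b - y) * std_normal_density (y - b) * p b)
      \<le> norm (std_normal_density (y - b) * exp (1 * \<bar>y - b\<bar>) * p b)"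
  proof (rule AE_I2)
    fix b
    have "\<bar>b - y\<bar> * (std_normal_density (y - b) * p b)
        \<le> exp \<bar>b - y\<bar> * (std_normal_density (y - b) * p b)"
      using p_pos[of b] by (intro mult_right_mono abs_le_exp) auto
    then show "norm ((b - y) * std_normal_density (y - b) * p b)
      \<le> norm (std_normal_density (y - b) * exp (1 * \<bar>y - b\<bar>) * p b)"
      using p_pos[of b] by (simp add: abs_mult mult_ac abs_minus_commute)
  qed
qed simp

lemma conv_shifted: "conv y = (LINT z|lborel. std_normal_density z * p (y + z))"
  unfolding conv_def
  by (subst lborel_integral_real_affine[where c=1 and t=y]) (simp_all add: std_normal_density_minus)

lemma conv_deriv_shifted: "conv_deriv y = (LINT z|lborel. z * std_normal_density z * p (y + z))"
  unfolding conv_deriv_def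
  by (subst lborel_integral_real_affine[where c=1 and t=y]) (simp_all add: std_normal_density_minus)

lemma integrable_conv_shifted: "integrable lborel (\<lambda>z. std_normal_density z * p (y + z))"
  using lborel_integrable_real_affine[OF integrable_conv[of y], of 1 y]
  by (simp add: std_normal_density_minus)

lemma integrable_conv_deriv_shifted: "integrable lborel (\<lambda>z. z * std_normal_density z * p (y + z))"
  using lborel_integrable_real_affine[OF integrable_conv_deriv[of y], of 1 y]
  by (simp add: std_normal_density_minus)

text \<open>Integrating the Taylor bound against \<open>p\<close> gives an error
  \<open>4 * h\<^sup>2 * R\<close> with \<open>R\<close> finite and independent of \<open>h\<close>,
  so the difference quotient is within \<open>4 * \<bar>h\<bar> * R\<close> of
  \<open>conv_deriv y\<close>.\<close>

lemma conv_has_derivative: "(conv has_real_derivative conv_deriv y) (at y)"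
proof -
  define R where "R = (LINT b|lborel. std_normal_density (y - b) * exp (3 * \<bar>y - b\<bar>) * p b)"
  have bound: "\<bar>conv (y + h) - conv y - h * conv_deriv y\<bar> \<le> 4 * h\<^sup>2 * R" if h: "\<bar>h\<bar> \<le> 1" for h
  proof -
    have eq: "conv (y + h) - conv y - h * conv_deriv y =
      (LINT b|lborel. std_normal_density (y + h - b) * p b - std_normal_density (y - b) * p b
          - h * ((b - y) * std_normal_density (y - b) * p b))"
      unfolding conv_def conv_deriv_def
      by (simp add: integrable_conv integrable_conv_deriv del: integrable_mult_right_iff)
    have "norm (conv (y + h) - conv y - h * conv_deriv y)
        \<le> (LINT b|lborel. 4 * h\<^sup>2 * (std_normal_density (y - b) * exp (3 * \<bar>y - b\<bar>) * p b))"
      unfolding eq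
    proof (rule Bochner_Integration.integral_norm_bound_integral)
      show "integrable lborel (\<lambda>b. std_normal_density (y + h - b) * p b - std_normal_density (y - b) * p b
          - h * ((b - y) * std_normal_density (y - b) * p b))"
        by (intro Bochner_Integration.integrable_diff integrable_mult_right integrable_conv integrable_conv_deriv)
      show "integrable lborel (\<lambda>b. 4 * h\<^sup>2 * (std_normal_density (y - b) * exp (3 * \<bar>y - b\<bar>) * p b))"
        by (intro integrable_mult_right integrable_gauss_exp_p)
      fix b
      have eq: "std_normal_density (y + h - b) * p b - std_normal_density (y - b) * p b
          - h * ((b - y) * std_normal_density (y - b) * p b)
        = (std_normal_density ((y - b) + h) - std_normal_density (y - b)
            + h * (y - b) * std_normal_density (y - b)) * p b"
        by (simp add: algebra_simps)
      show "norm (std_normal_density (y + h - b) * p b - std_normal_density (y - b) * p b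
          - h * ((b - y) * std_normal_density (y - b) * p b))
        \<le> 4 * h\<^sup>2 * (std_normal_density (y - b) * exp (3 * \<bar>y - b\<bar>) * p b)"
        unfolding eq real_norm_def abs_mult[of _ "p b"] abs_of_pos[OF p_pos]
        using mult_right_mono[OF std_normal_density_taylor[OF h, of "y - b"] less_imp_le[OF p_pos[of b]]]
        by (simp only: mult.assoc)
    qed
    then show ?thesis by (simp only: R_def real_norm_def integral_mult_right_zero)
  qed
  have "((\<lambda>h. (conv (y + h) - conv y) / h - conv_deriv y) \<longlongrightarrow> 0) (at 0)"
  proof (rule Lim_null_comparison)
    have "\<forall>\<^sub>F h::real in at 0. \<bar>h\<bar> \<le> 1 \<and> h \<noteq> 0"
      unfolding eventually_at by (intro exI[of _ 1]) auto
    then show "\<forall>\<^sub>F h in at 0. norm ((conv (y + h) - conv y) / h - conv_deriv y) \<le> 4 * \<bar>h\<bar> * R"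
    proof eventually_elim
      case (elim h)
      then have "(conv (y + h) - conv y) / h - conv_deriv y = (conv (y + h) - conv y - h * conv_deriv y) / h"
        by (simp add: field_simps)
      moreover have "\<bar>conv (y + h) - conv y - h * conv_deriv y\<bar> / \<bar>h\<bar> \<le> 4 * h\<^sup>2 * R / \<bar>h\<bar>"
        using bound[of h] elim by (intro divide_right_mono) auto
      moreover have "4 * h\<^sup>2 * R / \<bar>h\<bar> = 4 * \<bar>h\<bar> * R"
        using elim by (simp add: field_simps power2_eq_square)
      ultimately show ?case by (simp add: abs_divide)
    qed
    have "((\<lambda>h::real. 4 * \<bar>h\<bar> * R) \<longlongrightarrow> 4 * \<bar>0\<bar> * R) (at 0)"
      by (intro tendsto_intros)
    then show "((\<lambda>h::real. 4 * \<bar>h\<bar> * R) \<longlongrightarrow> 0) (at 0)" by simp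
  qed
  then show ?thesis by (simp add: DERIV_def LIM_zero_iff)
qed

text \<open>The growth bound read backwards, from \<open>y + z\<close> to \<open>y\<close>, bounds
  \<open>p (y + z)\<close> below by \<open>p y * exp (- S * \<bar>z\<bar>) / B\<close>. As
  \<open>d\<close> is the same for all \<open>y\<close>, estimates relative to \<open>p y\<close>
  become estimates relative to \<open>conv y\<close>.\<close>

lemma conv_lower: obtains d where "d > 0" "\<And>y. d * p y \<le> conv y"
proof
  define E where "E = (LINT z|lborel. std_normal_density z * exp (- S * \<bar>z\<bar>))"
  \<comment> \<open>The integrand is positive everywhere; if it vanished almost everywhere, the
    whole line would be a null set.\<close>
  have "\<not> (AE z in lborel. std_normal_density z * exp (- S * \<bar>z\<bar>) = 0)"
    using normal_density_pos[of 1 0] by (simp add: less_le eventually_False ae_filter_eq_bot_iff)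
  then have "E > 0"
    unfolding E_def
    using integral_nonneg_eq_0_iff_AE[OF integrable_std_normal_exp_abs[of "- S"]]
    by (simp add: order_less_le integral_nonneg_AE)
  then show "E / B > 0" using B_pos by simp
  fix y
  have "E / B * p y = (LINT z|lborel. p y / B * (std_normal_density z * exp (- S * \<bar>z\<bar>)))"
    by (simp add: E_def)
  also have "\<dots> \<le> conv y"
    unfolding conv_shifted
  proof (rule integral_mono)
    show "integrable lborel (\<lambda>z. p y / B * (std_normal_density z * exp (- S * \<bar>z\<bar>)))"
      by (intro integrable_mult_right integrable_std_normal_exp_abs)
    fix z
    have "p y * exp (- S * \<bar>z\<bar>) / B \<le> p (y + z)"
      using p_growth[of "y + z" "- z"] B_pos by (simp add: field_simps exp_minus)
    from mult_left_mono[OF this, of "std_normal_density z"]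
    show "p y / B * (std_normal_density z * exp (- S * \<bar>z\<bar>)) \<le> std_normal_density z * p (y + z)"
      by (simp add: mult_ac)
  qed (rule integrable_conv_shifted)
  finally show "E / B * p y \<le> conv y" .
qed

lemma conv_pos: "conv y > 0"
  using conv_lower p_pos by (metis mult_pos_pos order_less_le_trans)

lemma conv_deriv_bounded: "\<exists>C. \<forall>y. \<bar>conv_deriv y\<bar> \<le> C * p y"
proof (intro exI allI)
  fix y
  have "norm (conv_deriv y)
      \<le> (LINT z|lborel. B * p y * (std_normal_density z * exp ((S + 1) * \<bar>z\<bar>)))"
    unfolding conv_deriv_shifted
  proof (rule Bochner_Integration.integral_norm_bound_integral)
    show "integrable lborel (\<lambda>z. B * p y * (std_normal_density z * exp ((S + 1) * \<bar>z\<bar>)))"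
      by (intro integrable_mult_right integrable_std_normal_exp_abs)
    fix z
    have "\<bar>z\<bar> * p (y + z) \<le> exp \<bar>z\<bar> * (B * exp (S * \<bar>z\<bar>) * p y)"
      using p_pos[of "y + z"] by (intro mult_mono abs_le_exp p_growth) auto
    from mult_left_mono[OF this, of "std_normal_density z"]
    show "norm (z * std_normal_density z * p (y + z))
        \<le> B * p y * (std_normal_density z * exp ((S + 1) * \<bar>z\<bar>))"
      using p_pos[of "y + z"] by (simp add: abs_mult algebra_simps exp_add)
  qed (rule integrable_conv_deriv_shifted)
  then show "\<bar>conv_deriv y\<bar> \<le> B * (LINT z|lborel. std_normal_density z * exp ((S + 1) * \<bar>z\<bar>)) * p y"
    by (simp add: mult_ac)
qed

lemma conv_deriv_decay: "\<exists>C. \<forall>y. \<bar>y\<bar> \<ge> 1 \<longrightarrow> \<bar>conv_deriv y\<bar> \<le> C / \<bar>y\<bar> * p y"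
proof (intro exI allI impI)
  fix y :: real assume y: "\<bar>y\<bar> \<ge> 1"
  \<comment> \<open>The flatness bound at \<open>x = 1\<close>, \<open>h = 1\<close> has a
    nonnegative left side and \<open>p 1 > 0\<close>, which forces the sign of
    \<open>W\<close>.\<close>
  have W: "W \<ge> 0"
  proof -
    have "0 \<le> W * \<bar>1\<bar> * exp (S * \<bar>1\<bar>) / \<bar>1\<bar> * p 1"
      by (rule order_trans[OF abs_ge_zero p_flat]) simp
    then show ?thesis using p_pos[of 1] by (simp add: zero_le_mult_iff)
  qed
  have int0: "integrable lborel (\<lambda>z. z * std_normal_density z * p y)"
    using integrable_std_normal_moment[of 1] by (intro integrable_mult_left) (simp add: mult.commute)
  have "(LINT z|lborel. z * std_normal_density z * p y) = 0"
    using integral_std_normal_moment_odd[of 0] by (simp add: mult.commute[of _ "std_normal_density _"])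
  then have eq: "conv_deriv y =
      (LINT z|lborel. z * std_normal_density z * p (y + z) - z * std_normal_density z * p y)"
    unfolding conv_deriv_shifted
    by (subst Bochner_Integration.integral_diff) (use int0 integrable_conv_deriv_shifted in simp_all)
  have "norm (conv_deriv y)
      \<le> (LINT z|lborel. W / \<bar>y\<bar> * p y * (std_normal_density z * exp ((S + 2) * \<bar>z\<bar>)))"
    unfolding eq
  proof (rule Bochner_Integration.integral_norm_bound_integral)
    show "integrable lborel (\<lambda>z. W / \<bar>y\<bar> * p y * (std_normal_density z * exp ((S + 2) * \<bar>z\<bar>)))"
      by (intro integrable_mult_right integrable_std_normal_exp_abs)
    show "integrable lborel (\<lambda>z. z * std_normal_density z * p (y + z) - z * std_normal_density z * p y)"
      by (intro Bochner_Integration.integrable_diff integrable_conv_deriv_shifted int0)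
    fix z
    \<comment> \<open>Two factors \<open>\<bar>z\<bar>\<close> occur, one from the integrand and one
      from the flatness bound. Each is absorbed into \<open>exp \<bar>z\<bar>\<close>, whence the
      rate \<open>S + 2\<close>.\<close>
    have "\<bar>z\<bar> * \<bar>p (y + z) - p y\<bar> \<le> exp \<bar>z\<bar> * (W * exp \<bar>z\<bar> * exp (S * \<bar>z\<bar>) / \<bar>y\<bar> * p y)"
    proof (rule mult_mono[OF abs_le_exp])
      have "W * \<bar>z\<bar> * exp (S * \<bar>z\<bar>) / \<bar>y\<bar> * p y \<le> W * exp \<bar>z\<bar> * exp (S * \<bar>z\<bar>) / \<bar>y\<bar> * p y"
        using W p_pos[of y] abs_le_exp[of z]
        by (intro mult_right_mono divide_right_mono mult_left_mono) auto
      then show "\<bar>p (y + z) - p y\<bar> \<le> W * exp \<bar>z\<bar> * exp (S * \<bar>z\<bar>) / \<bar>y\<bar> * p y"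
        using p_flat[OF y, of z] by linarith
    qed auto
    from mult_left_mono[OF this, of "std_normal_density z"]
    have "std_normal_density z * (\<bar>z\<bar> * \<bar>p (y + z) - p y\<bar>)
        \<le> W / \<bar>y\<bar> * p y * (std_normal_density z * (exp \<bar>z\<bar> * exp \<bar>z\<bar> * exp (S * \<bar>z\<bar>)))"
      by (simp add: mult_ac)
    moreover have "exp \<bar>z\<bar> * exp \<bar>z\<bar> * exp (S * \<bar>z\<bar>) = exp ((S + 2) * \<bar>z\<bar>)"
      by (simp add: exp_add [symmetric] algebra_simps)
    moreover have "z * std_normal_density z * p (y + z) - z * std_normal_density z * p y
        = z * std_normal_density z * (p (y + z) - p y)" by (simp add: right_diff_distrib)
    ultimately show "norm (z * std_normal_density z * p (y + z) - z * std_normal_density z * p y)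
        \<le> W / \<bar>y\<bar> * p y * (std_normal_density z * exp ((S + 2) * \<bar>z\<bar>))"
      by (simp only: real_norm_def abs_mult) (simp add: mult_ac)
  qed
  then show "\<bar>conv_deriv y\<bar>
      \<le> W * (LINT z|lborel. std_normal_density z * exp ((S + 2) * \<bar>z\<bar>)) / \<bar>y\<bar> * p y"
    by (simp add: mult_ac)
qed

text \<open>Stated for a single \<open>y\<close>, so that \<open>c\<close> may depend on
  \<open>y\<close>: it is a constant for the global bound and \<open>C / \<bar>y\<bar>\<close> in
  the tails.\<close>

lemma bound_via_conv:
  assumes "\<bar>x\<bar> \<le> c * p y" "d > 0" "d * p y \<le> conv y"
  shows "\<bar>x / conv y\<bar> \<le> c / d"
proof -
  have c: "c \<ge> 0" using order_trans[OF abs_ge_zero assms(1)] p_pos[of y] by (simp add: zero_le_mult_iff)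
  have "\<bar>x\<bar> \<le> c / d * (d * p y)" using assms by simp
  also have "\<dots> \<le> c / d * conv y" using assms c by (intro mult_left_mono) auto
  finally show ?thesis using conv_pos[of y] by (simp add: abs_divide pos_divide_le_eq)
qed

lemma log_deriv_bounded: "\<exists>C. \<forall>y. \<bar>conv_deriv y / conv y\<bar> \<le> C"
proof -
  obtain d where d: "d > 0" "\<And>y. d * p y \<le> conv y" by (rule conv_lower) blast
  obtain C where C: "\<And>y. \<bar>conv_deriv y\<bar> \<le> C * p y" using conv_deriv_bounded by blast
  show ?thesis using bound_via_conv[OF C d] by blast
qed

lemma log_deriv_tendsto_0: "((\<lambda>y. conv_deriv y / conv y) \<longlongrightarrow> 0) at_infinity"
proof -
  obtain d where d: "d > 0" "\<And>y. d * p y \<le> conv y" by (rule conv_lower) blast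
  obtain C where C: "\<And>y. \<bar>y\<bar> \<ge> 1 \<Longrightarrow> \<bar>conv_deriv y\<bar> \<le> C / \<bar>y\<bar> * p y"
    using conv_deriv_decay by blast
  show ?thesis
  proof (rule Lim_null_comparison)
    show "\<forall>\<^sub>F y in at_infinity. norm (conv_deriv y / conv y) \<le> C / d * norm (inverse y)"
      unfolding eventually_at_infinity
    proof (intro exI[of _ 1] allI impI)
      fix y :: real assume "norm y \<ge> 1"
      then show "norm (conv_deriv y / conv y) \<le> C / d * norm (inverse y)"
        using bound_via_conv[OF C d] by (simp add: field_simps)
    qed
    show "((\<lambda>y::real. C / d * norm (inverse y)) \<longlongrightarrow> 0) at_infinity"
      by (rule tendsto_mult_right_zero, rule tendsto_norm_zero, rule tendsto_inverse_0)
  qed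
qed

lemma deriv_ln_conv: "deriv (\<lambda>t. ln (conv t)) y = conv_deriv y / conv y"
  using DERIV_chain2[OF DERIV_ln[OF conv_pos] conv_has_derivative, of y]
  by (intro DERIV_imp_deriv) (simp add: field_simps)

end

section \<open>Flatness of the polynomially decaying kernel\<close>

lemma one_plus_powr_le_exp: "(1 + t) powr a \<le> exp (a * t)" if "t \<ge> 0" "a \<ge> 0" for t a :: real
proof -
  have "(1 + t) powr a = exp (a * ln (1 + t))" using that by (simp add: powr_def)
  also have "\<dots> \<le> exp (a * t)" using that ln_add_one_self_le_self[of t] by (simp add: mult_left_mono)
  finally show ?thesis .
qed

lemma powr_minus_ratio:
  fixes V V' c s :: real
  assumes "0 < V" "V \<le> c * V'" "0 < V'" "0 \<le> s"
  shows "V' powr (- s) \<le> c powr s * V powr (- s)"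
proof -
  have c: "c > 0" using assms by (metis less_le_trans zero_less_mult_pos2)
  have "V powr s \<le> (c * V') powr s" using assms by (intro powr_mono2) auto
  also have "\<dots> = c powr s * V' powr s" using c assms by (simp add: powr_mult)
  finally show ?thesis using assms c by (simp add: powr_minus field_simps)
qed

text \<open>Up to a constant, the density of \<beta> once \<lambda> is integrated out, with
  \<open>c = gam / 2\<close> and \<open>s = e + 1 / a\<close>.\<close>

definition kern :: "real \<Rightarrow> real \<Rightarrow> real \<Rightarrow> real \<Rightarrow> real \<Rightarrow> real" where
  "kern f c a s x = (f + c * \<bar>x\<bar> powr a) powr (- s)"

context
  fixes f c a s :: real
  assumes pos: "f > 0" "c > 0" "a > 0" "s > 0"
begin

lemma kern_base_pos: "f + c * \<bar>x\<bar> powr a > 0"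
  using pos by (intro add_pos_nonneg) auto

lemma kern_pos: "kern f c a s x > 0"
  using kern_base_pos[of x] by (simp add: kern_def)

text \<open>Stretching the argument by \<open>1 + t\<close> enlarges the base by at most
  \<open>(1 + t) powr a \<le> exp (a * t)\<close>, and the power \<open>- s\<close> turns this into
  a bound on the kernel. Measuring the displacement relatively yields both a rate in
  \<open>\<bar>h\<bar>\<close> and one in \<open>\<bar>h\<bar> / \<bar>x\<bar>\<close>.\<close>

lemma kern_scaled:
  assumes "\<bar>x\<bar> \<le> \<bar>x'\<bar> * (1 + t)" "t \<ge> 0"
  shows "kern f c a s x' \<le> exp (a * s * t) * kern f c a s x"
proof -
  have "\<bar>x\<bar> powr a \<le> (\<bar>x'\<bar> * (1 + t)) powr a" using assms pos by (intro powr_mono2) auto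
  also have "\<dots> = \<bar>x'\<bar> powr a * (1 + t) powr a" using assms by (simp add: powr_mult)
  also have "\<dots> \<le> \<bar>x'\<bar> powr a * exp (a * t)"
    using assms pos by (intro mult_left_mono one_plus_powr_le_exp) auto
  finally have "c * \<bar>x\<bar> powr a \<le> c * (\<bar>x'\<bar> powr a * exp (a * t))" using pos by simp
  moreover have "f * 1 \<le> f * exp (a * t)" using pos assms by (intro mult_left_mono) auto
  ultimately have "f + c * \<bar>x\<bar> powr a \<le> exp (a * t) * (f + c * \<bar>x'\<bar> powr a)"
    by (simp add: algebra_simps)
  from powr_minus_ratio[OF kern_base_pos this kern_base_pos, of s] pos show ?thesis
    unfolding kern_def by (simp add: powr_def [of "exp _"] mult_ac)
qed

text \<open>If \<open>\<bar>x + h\<bar> \<ge> 1\<close>, the displacement relative to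
  \<open>x + h\<close> is at most \<open>\<bar>h\<bar>\<close> and scaling suffices. Otherwise
  \<open>\<bar>x\<bar> \<le> 1 + \<bar>h\<bar>\<close>, so the base at \<open>x\<close> is at most
  \<open>(f + c) * exp (a * \<bar>h\<bar>)\<close>, while the base at \<open>x + h\<close> is at
  least \<open>f\<close>; this costs the factor \<open>(1 + c / f) powr s\<close>.\<close>

lemma kern_growth:
  "kern f c a s (x + h) \<le> (1 + c / f) powr s * exp (a * s * \<bar>h\<bar>) * kern f c a s x"
proof (cases "\<bar>x + h\<bar> \<ge> 1")
  case True
  then have "1 * \<bar>h\<bar> \<le> \<bar>x + h\<bar> * \<bar>h\<bar>" by (intro mult_right_mono) auto
  then have "kern f c a s (x + h) \<le> exp (a * s * \<bar>h\<bar>) * kern f c a s x"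
    by (intro kern_scaled) (auto simp: distrib_left)
  moreover have "1 * (exp (a * s * \<bar>h\<bar>) * kern f c a s x) \<le> (1 + c / f) powr s * (exp (a * s * \<bar>h\<bar>) * kern f c a s x)"
    using pos kern_pos[of x] by (intro mult_right_mono ge_one_powr_ge_zero) auto
  ultimately show ?thesis unfolding mult.assoc mult_1_left by (rule order_trans)
next
  case False
  have "\<bar>x\<bar> powr a \<le> (1 + \<bar>h\<bar>) powr a" using False pos by (intro powr_mono2) auto
  also have "\<dots> \<le> exp (a * \<bar>h\<bar>)" using pos by (intro one_plus_powr_le_exp) auto
  finally have "c * \<bar>x\<bar> powr a \<le> c * exp (a * \<bar>h\<bar>)" using pos by simp
  moreover have "f * 1 \<le> f * exp (a * \<bar>h\<bar>)" using pos by (intro mult_left_mono) auto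
  ultimately have "f + c * \<bar>x\<bar> powr a \<le> exp (a * \<bar>h\<bar>) * (f + c)"
    by (simp add: algebra_simps)
  also have "\<dots> = (1 + c / f) * exp (a * \<bar>h\<bar>) * f" using pos by (simp add: field_simps)
  also have "\<dots> \<le> (1 + c / f) * exp (a * \<bar>h\<bar>) * (f + c * \<bar>x + h\<bar> powr a)"
    using pos by (intro mult_left_mono) auto
  finally have "f + c * \<bar>x\<bar> powr a \<le> (1 + c / f) * exp (a * \<bar>h\<bar>) * (f + c * \<bar>x + h\<bar> powr a)" .
  from powr_minus_ratio[OF kern_base_pos this kern_base_pos, of s] pos show ?thesis
    unfolding kern_def by (simp add: powr_mult powr_def [of "exp _"] mult_ac)
qed

text \<open>The change is of first order in the relative displacement
  \<open>t = \<bar>h\<bar> / \<bar>x\<bar>\<close>. A decrease is controlled by scaling and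
  \<open>exp (- v) \<ge> 1 - v\<close>. For an increase with
  \<open>\<bar>h\<bar> \<le> \<bar>x\<bar> / 2\<close>, the point \<open>x + h\<close> keeps at
  least half the modulus of \<open>x\<close>, so scaling applies with \<open>2 * t\<close>.\<close>

lemma kern_flat:
  assumes x: "\<bar>x\<bar> \<ge> 1"
  shows "\<bar>kern f c a s (x + h) - kern f c a s x\<bar>
    \<le> 2 * (a * s + (1 + c / f) powr s) * \<bar>h\<bar> * exp (2 * (a * s) * \<bar>h\<bar>) / \<bar>x\<bar> * kern f c a s x"
proof -
  define t where "t = \<bar>h\<bar> / \<bar>x\<bar>"
  define m where "m = a * s"
  define A where "A = (1 + c / f) powr s"
  define u where "u = kern f c a s"
  have m: "m > 0" using pos by (simp add: m_def)
  have A: "A \<ge> 0" by (simp add: A_def)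
  have u: "u y > 0" for y unfolding u_def by (rule kern_pos)
  have t0: "t \<ge> 0" and th: "t \<le> \<bar>h\<bar>" and xt: "\<bar>x\<bar> * t = \<bar>h\<bar>"
    using x by (auto simp: t_def field_simps mult_left_mono mult_le_cancel_left1)
  have e1: "1 \<le> exp (2 * m * \<bar>h\<bar>)" using m by simp
  let ?R = "2 * (m + A) * t * exp (2 * m * \<bar>h\<bar>)"
  have "u x \<le> exp (m * t) * u (x + h)"
    unfolding u_def m_def using xt t0 by (intro kern_scaled) (auto simp: distrib_left)
  then have "exp (- (m * t)) * u x \<le> u (x + h)" by (simp add: exp_minus field_simps)
  moreover have "(1 - m * t) * u x \<le> exp (- (m * t)) * u x"
    using exp_ge_add_one_self[of "- (m * t)"] u[of x] by (intro mult_right_mono) auto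
  ultimately have "u x - u (x + h) \<le> m * t * u x" by (simp add: algebra_simps)
  also have "m * t * 1 \<le> ?R"
    using m A t0 e1 by (intro mult_mono) (auto simp: mult_right_mono)
  then have "m * t * u x \<le> ?R * u x" using u[of x] by (intro mult_right_mono) auto
  finally have lower: "u x - u (x + h) \<le> ?R * u x" .
  have upper: "u (x + h) - u x \<le> ?R * u x"
  proof (cases "\<bar>h\<bar> \<le> \<bar>x\<bar> / 2")
    case True
    then have "\<bar>x\<bar> \<le> 2 * \<bar>x + h\<bar>" using abs_triangle_ineq4[of "x + h" h] by simp
    then have "\<bar>x\<bar> * (2 * t) \<le> 2 * \<bar>x + h\<bar> * (2 * t)" using t0 by (intro mult_right_mono) auto
    then have "\<bar>h\<bar> \<le> \<bar>x + h\<bar> * (2 * t)" using xt by (simp add: algebra_simps)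
    then have "u (x + h) \<le> exp (m * (2 * t)) * u x"
      unfolding u_def m_def using t0 by (intro kern_scaled) (auto simp: distrib_left)
    then have "u (x + h) - u x \<le> (exp (2 * m * t) - 1) * u x" by (simp add: algebra_simps)
    also have "\<dots> \<le> (2 * m * t * exp (2 * m * t)) * u x"
      using u[of x] by (intro mult_right_mono exp_minus_one_le) auto
    also have "\<dots> \<le> ?R * u x"
      using u[of x] m A t0 th by (intro mult_right_mono mult_mono) auto
    finally show ?thesis .
  next
    case False
    \<comment> \<open>A large displacement makes \<open>2 * t\<close> at least 1, so the crude
      growth bound may be multiplied by it to supply the missing factor \<open>t\<close>.\<close>
    then have t2: "2 * t \<ge> 1" using x by (simp add: t_def field_simps)
    have "u (x + h) \<le> A * exp (m * \<bar>h\<bar>) * u x"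
      using kern_growth[of x h] by (simp add: u_def m_def A_def)
    also have "\<dots> \<le> ?R * u x"
    proof -
      have "A * 1 \<le> (m + A) * (2 * t)" using m A t2 by (intro mult_mono) auto
      then have "A * exp (m * \<bar>h\<bar>) \<le> ((m + A) * (2 * t)) * exp (2 * m * \<bar>h\<bar>)"
        using m A t0 by (intro mult_mono) auto
      then show ?thesis using u[of x] by (intro mult_right_mono) (auto simp: mult_ac)
    qed
    finally show ?thesis using u[of x] by linarith
  qed
  from lower upper have "\<bar>u (x + h) - u x\<bar> \<le> ?R * u x" by linarith
  then show ?thesis by (simp add: u_def m_def A_def t_def mult_ac)
qed

end

section \<open>Stability of the flatness bounds under mixing\<close>

lemma flat_bounds_mono:
  assumes "flat_bounds q B S W" "B \<le> B'" "S \<le> S'" "W \<le> W'" "0 \<le> B" "0 \<le> W" "\<And>x. q x \<ge> 0"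
  shows "flat_bounds q B' S' W'"
proof -
  have "B * exp (S * \<bar>h\<bar>) * q x \<le> B' * exp (S' * \<bar>h\<bar>) * q x" for x h
    using assms by (intro mult_right_mono mult_mono) (auto intro: mult_right_mono)
  moreover have "W * \<bar>h\<bar> * exp (S * \<bar>h\<bar>) / \<bar>x\<bar> * q x \<le> W' * \<bar>h\<bar> * exp (S' * \<bar>h\<bar>) / \<bar>x\<bar> * q x" for x h
    using assms by (intro mult_right_mono divide_right_mono mult_mono) (auto intro: mult_right_mono)
  ultimately show ?thesis using assms(1) unfolding flat_bounds_def by (meson order_trans)
qed

lemma flat_bounds_cmult:
  assumes "flat_bounds q B S W" "k \<ge> 0"
  shows "flat_bounds (\<lambda>x. k * q x) B S W"
proof -
  have "k * q (x + h) \<le> B * exp (S * \<bar>h\<bar>) * (k * q x)" for x h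
    using mult_left_mono[of "q (x + h)" "B * exp (S * \<bar>h\<bar>) * q x" k] assms
    by (simp add: flat_bounds_def mult_ac)
  moreover have "\<bar>k * q (x + h) - k * q x\<bar> \<le> W * \<bar>h\<bar> * exp (S * \<bar>h\<bar>) / \<bar>x\<bar> * (k * q x)"
    if "\<bar>x\<bar> \<ge> 1" for x h
    using mult_left_mono[of "\<bar>q (x + h) - q x\<bar>" "W * \<bar>h\<bar> * exp (S * \<bar>h\<bar>) / \<bar>x\<bar> * q x" k] assms that
    by (simp add: flat_bounds_def mult_ac right_diff_distrib [symmetric] abs_mult)
  ultimately show ?thesis unfolding flat_bounds_def by blast
qed

lemma flat_bounds_add:
  assumes "flat_bounds q B S W" "flat_bounds r B S W"
  shows "flat_bounds (\<lambda>x. q x + r x) B S W"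
  unfolding flat_bounds_def
proof (intro conjI allI impI)
  fix x h :: real
  show "q (x + h) + r (x + h) \<le> B * exp (S * \<bar>h\<bar>) * (q x + r x)"
    using assms unfolding flat_bounds_def distrib_left by (intro add_mono) auto
  assume "\<bar>x\<bar> \<ge> 1"
  then have "\<bar>q (x + h) - q x\<bar> + \<bar>r (x + h) - r x\<bar> \<le> W * \<bar>h\<bar> * exp (S * \<bar>h\<bar>) / \<bar>x\<bar> * (q x + r x)"
    using assms unfolding flat_bounds_def distrib_left by (intro add_mono) auto
  then show "\<bar>q (x + h) + r (x + h) - (q x + r x)\<bar> \<le> W * \<bar>h\<bar> * exp (S * \<bar>h\<bar>) / \<bar>x\<bar> * (q x + r x)"
    by linarith
qed

text \<open>Constants common to all \<open>a\<close> can be pulled out of the integral; the second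
  bound also needs the absolute value moved inside it.\<close>

lemma flat_bounds_set_integral:
  fixes q :: "real \<Rightarrow> real \<Rightarrow> real"
  assumes q: "\<And>a. a \<in> A \<Longrightarrow> flat_bounds (q a) B S W"
    and int: "\<And>x. set_integrable lborel A (\<lambda>a. q a x)"
  shows "flat_bounds (\<lambda>x. LINT a:A|lborel. q a x) B S W"
  unfolding flat_bounds_def
proof (intro conjI allI impI)
  fix x h :: real
  have "(LINT a:A|lborel. q a (x + h)) \<le> (LINT a:A|lborel. B * exp (S * \<bar>h\<bar>) * q a x)"
    using q by (intro set_integral_mono int set_integrable_mult_right) (auto simp: flat_bounds_def)
  then show "(LINT a:A|lborel. q a (x + h)) \<le> B * exp (S * \<bar>h\<bar>) * (LINT a:A|lborel. q a x)" by simp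
  assume x: "\<bar>x\<bar> \<ge> 1"
  have "(LINT a:A|lborel. q a (x + h)) - (LINT a:A|lborel. q a x) = (LINT a:A|lborel. q a (x + h) - q a x)"
    by (simp add: int set_integral_diff)
  also have "\<bar>\<dots>\<bar> \<le> (LINT a:A|lborel. \<bar>q a (x + h) - q a x\<bar>)"
    using set_integral_norm_bound[OF set_integral_diff(1)[OF int int], of "x + h" x] by simp
  also have "\<dots> \<le> (LINT a:A|lborel. W * \<bar>h\<bar> * exp (S * \<bar>h\<bar>) / \<bar>x\<bar> * q a x)"
    using q x by (intro set_integral_mono int set_integrable_mult_right set_integrable_abs set_integral_diff)
      (auto simp: flat_bounds_def)
  finally show "\<bar>(LINT a:A|lborel. q a (x + h)) - (LINT a:A|lborel. q a x)\<bar>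
      \<le> W * \<bar>h\<bar> * exp (S * \<bar>h\<bar>) / \<bar>x\<bar> * (LINT a:A|lborel. q a x)" by simp
qed

section \<open>Integrating out the scale: the prior of \<beta> given the exponent\<close>

definition mix_const :: "real \<Rightarrow> real \<Rightarrow> real \<Rightarrow> real \<Rightarrow> real" where
  "mix_const e f gam a = a * gam powr (1 / a) / (2 powr (1 / a + 1) * Gamma (1 / a))
     * (f powr e / Gamma e) * Gamma (e + 1 / a)"

text \<open>The density of \<beta> given \<alpha> for one Gamma component. \<open>mix_const\<close>
  collects the normalizing constants of the exponential-power and Gamma densities and the value
  \<open>Gamma (e + 1 / a)\<close> produced by the \<lambda> integral.\<close>

definition scale_mix :: "real \<Rightarrow> real \<Rightarrow> real \<Rightarrow> real \<Rightarrow> real \<Rightarrow> real" where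
  "scale_mix e f gam a b = mix_const e f gam a * kern f (gam / 2) a (e + 1 / a) b"

text \<open>Euler's integral after the substitution \<open>t = r * l\<close>. This form delivers
  integrability together with the value; the Fubini argument for \<lambda> uses both.\<close>

lemma has_bochner_integral_gamma_rate:
  fixes s r :: real
  assumes s: "s > 0" and r: "r > 0"
  shows "has_bochner_integral lborel (\<lambda>l. indicator {0<..} l * (l powr (s - 1) * exp (- r * l)))
    (Gamma s * r powr (- s))"
proof -
  have "has_bochner_integral lborel (\<lambda>t. indicator {0..} t * t powr (s - 1) / exp t) (Gamma s)"
    using s Gamma_conv_nn_integral_real[OF s] 
    by (intro has_bochner_integral_nn_integral) (auto simp: less_imp_le)
  then have "has_bochner_integral lborel
      (\<lambda>t. indicator {0..} (0 + r * t) * (0 + r * t) powr (s - 1) / exp (0 + r * t)) (Gamma s /\<^sub>R \<bar>r\<bar>)"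
    using r by (subst (asm) lborel_has_bochner_integral_real_affine_iff[where c=r and t=0]) auto
  \<comment> \<open>The factor cancels the \<open>r powr (s - 1)\<close> created by the
    substitution; with the Jacobian \<open>1 / r\<close> it leaves
    \<open>r powr (- s)\<close>.\<close>
  from has_bochner_integral_mult_right[OF this, of "r powr (1 - s)"]
  have "has_bochner_integral lborel (\<lambda>t. r powr (1 - s) *
      (indicator {0..} (0 + r * t) * (0 + r * t) powr (s - 1) / exp (0 + r * t)))
      (r powr (1 - s) * (Gamma s /\<^sub>R \<bar>r\<bar>))" by simp
  moreover have "r powr (1 - s) * (Gamma s /\<^sub>R \<bar>r\<bar>) = Gamma s * r powr (- s)"
    using r by (simp add: powr_diff powr_minus field_simps)
  moreover have "r powr (1 - s) * (indicator {0..} (0 + r * t) * (0 + r * t) powr (s - 1) / exp (0 + r * t))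
      = indicator {0<..} t * (t powr (s - 1) * exp (- r * t))" for t
  proof (cases "t > 0")
    case True
    have "r powr (1 - s) * r powr (s - 1) = 1" using r by (simp add: powr_add [symmetric])
    then show ?thesis using True r by (simp add: indicator_def powr_mult exp_minus field_simps)
  next
    case False
    \<comment> \<open>At \<open>t = 0\<close> the two indicators differ, but there
      \<open>0 powr (s - 1) = 0\<close>.\<close>
    then show ?thesis using r by (cases "t = 0") (auto simp: indicator_def zero_le_mult_iff)
  qed
  ultimately show ?thesis by (simp only:)
qed

context
  fixes e f gam a :: real
  assumes pos: "e > 0" "f > 0" "gam > 0" "a > 0"
begin

lemma mix_const_pos: "mix_const e f gam a > 0"
  using pos unfolding mix_const_def by (intro mult_pos_pos divide_pos_pos Gamma_real_pos) (auto intro: add_pos_pos)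

lemma scale_mix_pos: "scale_mix e f gam a b > 0"
  unfolding scale_mix_def using pos by (intro mult_pos_pos mix_const_pos kern_pos) (auto intro: add_pos_pos)

lemma scale_mix_le: "scale_mix e f gam a b \<le> scale_mix e f gam a 0"
  unfolding scale_mix_def kern_def using pos mix_const_pos add_pos_pos[of e "1 / a"]
  by (intro mult_left_mono powr_mono2') auto

lemma scale_mix_measurable [measurable]: "scale_mix e f gam a \<in> borel_measurable borel"
  unfolding scale_mix_def[abs_def] kern_def[abs_def] by measurable

lemma gamma_gg_nonneg: "0 \<le> gamma_density l e f * gg_prior gam l a b"
  using pos by (auto simp: gamma_density_def gg_prior_def intro!: mult_nonneg_nonneg divide_nonneg_nonneg less_imp_le[OF Gamma_real_pos])

text \<open>Conjugacy: the product is again a Gamma kernel in \<open>l\<close>, with shape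
  \<open>e + 1 / a\<close> and rate \<open>f + gam / 2 * \<bar>b\<bar> powr a\<close>.\<close>

lemma has_bochner_integral_gamma_gg:
  "has_bochner_integral lborel (\<lambda>l. indicator {0<..} l * (gamma_density l e f * gg_prior gam l a b))
    (scale_mix e f gam a b)"
proof -
  define K where "K = a * gam powr (1 / a) / (2 powr (1 / a + 1) * Gamma (1 / a)) * (f powr e / Gamma e)"
  define r where "r = f + gam / 2 * \<bar>b\<bar> powr a"
  have r: "r > 0" unfolding r_def using pos by (intro add_pos_nonneg) auto
  have s: "e + 1 / a > 0" using pos by (intro add_pos_pos) auto
  have "indicator {0<..} l * (gamma_density l e f * gg_prior gam l a b)
      = K * (indicator {0<..} l * (l powr (e + 1 / a - 1) * exp (- r * l)))" for l
  proof (cases "l > 0")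
    case True
    have "l powr (e + 1 / a - 1) = l powr (e - 1) * l powr (1 / a)"
      by (simp add: powr_add [symmetric] algebra_simps)
    moreover have "exp (- r * l) = exp (- f * l) * exp (- (gam / 2) * l * \<bar>b\<bar> powr a)"
      by (simp add: exp_add [symmetric] r_def algebra_simps)
    ultimately show ?thesis using True
      by (simp only: gamma_density_def gg_prior_def K_def if_True) (simp add: mult_ac)
  qed simp
  moreover have "scale_mix e f gam a b = K * (Gamma (e + 1 / a) * r powr (- (e + 1 / a)))"
    by (simp only: scale_mix_def mix_const_def kern_def K_def r_def mult.assoc)
  ultimately show ?thesis
    using has_bochner_integral_mult_right[OF has_bochner_integral_gamma_rate[OF s r], of K]
    by (simp only: simp_thms)
qed

lemma integrable_times_scale_mix:
  assumes "integrable lborel G"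
  shows "integrable lborel (\<lambda>b. G b * scale_mix e f gam a b)"
proof (rule Bochner_Integration.integrable_bound)
  show "integrable lborel (\<lambda>b. G b * scale_mix e f gam a 0)" using assms by simp
  show "AE b in lborel. norm (G b * scale_mix e f gam a b) \<le> norm (G b * scale_mix e f gam a 0)"
    using scale_mix_le scale_mix_pos by (simp add: abs_mult mult_left_mono less_imp_le)
  show "(\<lambda>b. G b * scale_mix e f gam a b) \<in> borel_measurable lborel"
    using borel_measurable_integrable[OF assms] by simp
qed

text \<open>Fubini applies because the Gamma density times the prior is nonnegative: integrating the
  absolute value over \<open>l\<close> leaves
  \<open>\<bar>G b\<bar> * scale_mix e f gam a b\<close>, integrable since \<open>scale_mix\<close>
  is largest at \<open>b = 0\<close>.\<close>

lemma integral_gamma_gg_swap: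
  assumes G: "integrable lborel G"
  shows "(LINT l:{0<..}|lborel. gamma_density l e f * (LINT b|lborel. G b * gg_prior gam l a b))
    = (LINT b|lborel. G b * scale_mix e f gam a b)"
proof -
  have Gm [measurable]: "G \<in> borel_measurable borel" using borel_measurable_integrable[OF G] by simp
  define F where "F b l = G b * (indicator {0<..} l * (gamma_density l e f * gg_prior gam l a b))" for b l
  have [measurable]: "case_prod F \<in> borel_measurable (lborel \<Otimes>\<^sub>M lborel)"
    unfolding F_def gamma_density_def gg_prior_def by measurable
  have norm: "norm (F b l) = \<bar>G b\<bar> * (indicator {0<..} l * (gamma_density l e f * gg_prior gam l a b))" for b l
    using gamma_gg_nonneg[of l b] by (simp add: F_def abs_mult [of "G b"] abs_mult [of "indicator _ _"])
  have "integrable (lborel \<Otimes>\<^sub>M lborel) (case_prod F)"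
  proof (rule lborel_pair.Fubini_integrable)
    show "integrable lborel (\<lambda>x. LINT y|lborel. norm (case (x, y) of (x, xa) \<Rightarrow> F x xa))"
      using integrable_times_scale_mix[OF integrable_abs[OF G]]
      by (simp add: norm [unfolded real_norm_def] has_bochner_integral_integral_eq[OF has_bochner_integral_gamma_gg])
    show "AE x in lborel. integrable lborel (\<lambda>y. case (x, y) of (x, xa) \<Rightarrow> F x xa)"
      using integrable.intros[OF has_bochner_integral_gamma_gg] by (simp add: F_def)
  qed measurable
  from lborel_pair.Fubini_integral[OF this]
  have "(LINT l|lborel. LINT b|lborel. F b l) = (LINT b|lborel. LINT l|lborel. F b l)" .
  also have "(LINT b|lborel. LINT l|lborel. F b l) = (LINT b|lborel. G b * scale_mix e f gam a b)"
    by (simp add: F_def has_bochner_integral_integral_eq[OF has_bochner_integral_gamma_gg])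
  also have "(LINT l|lborel. LINT b|lborel. F b l)
     = (LINT l:{0<..}|lborel. gamma_density l e f * (LINT b|lborel. G b * gg_prior gam l a b))"
  proof -
    have "F b l = (indicator {0<..} l * gamma_density l e f) * (G b * gg_prior gam l a b)" for b l
      by (simp add: F_def mult_ac)
    then show ?thesis by (simp add: set_lebesgue_integral_def mult.assoc)
  qed
  finally show ?thesis .
qed

end

text \<open>Uniformity in \<open>a\<close>: the exponent \<open>e + 1 / a\<close> is largest at
  \<open>a = k1\<close>, the rate \<open>a * (e + 1 / a)\<close> is at most \<open>k2 * s\<close>,
  and \<open>1 + gam / 2 / f \<ge> 1\<close> makes its power monotone in the exponent. The growth
  rate is doubled to share one rate with the flatness bound.\<close>

lemma scale_mix_flat_bounds:
  fixes e f gam k1 k2 a :: real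
  assumes pos: "e > 0" "f > 0" "gam > 0" and a: "0 < k1" "k1 \<le> a" "a \<le> k2"
  defines "s \<equiv> e + 1 / k1"
  defines "A \<equiv> (1 + gam / 2 / f) powr s"
  shows "flat_bounds (scale_mix e f gam a) A (2 * (k2 * s)) (2 * (k2 * s + A))"
proof -
  define sa where "sa = e + 1 / a"
  define Aa where "Aa = (1 + gam / 2 / f) powr sa"
  have a0: "a > 0" using a by linarith
  have sa0: "sa > 0" using pos a0 by (auto simp: sa_def intro: add_pos_pos)
  have sa_le: "sa \<le> s" using a a0 by (auto simp: sa_def s_def intro: divide_left_mono)
  have Aa: "0 \<le> Aa" "Aa \<le> A"
    unfolding Aa_def A_def using pos sa_le by (auto intro!: powr_mono)
  have as: "0 \<le> a * sa" "a * sa \<le> k2 * s"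
    using a a0 sa0 sa_le by (auto intro: mult_mono)
  have kpos: "gam / 2 > 0" using pos by simp
  note k = kern_pos[OF pos(2) kpos a0 sa0]
  have "flat_bounds (kern f (gam / 2) a sa) Aa (2 * (a * sa)) (2 * (a * sa + Aa))"
    unfolding flat_bounds_def
  proof (intro conjI allI impI)
    fix x h :: real
    have "Aa * exp (a * sa * \<bar>h\<bar>) * kern f (gam / 2) a sa x \<le> Aa * exp (2 * (a * sa) * \<bar>h\<bar>) * kern f (gam / 2) a sa x"
      using Aa as k[of x] by (intro mult_right_mono mult_left_mono) (auto simp: mult_right_mono)
    then show "kern f (gam / 2) a sa (x + h) \<le> Aa * exp (2 * (a * sa) * \<bar>h\<bar>) * kern f (gam / 2) a sa x"
      using kern_growth[OF pos(2) kpos a0 sa0, of x h] by (simp add: Aa_def)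
  next
    fix x h :: real assume "\<bar>x\<bar> \<ge> 1"
    from kern_flat[OF pos(2) kpos a0 sa0 this]
    show "\<bar>kern f (gam / 2) a sa (x + h) - kern f (gam / 2) a sa x\<bar>
      \<le> 2 * (a * sa + Aa) * \<bar>h\<bar> * exp (2 * (a * sa) * \<bar>h\<bar>) / \<bar>x\<bar> * kern f (gam / 2) a sa x"
      unfolding Aa_def .
  qed
  then have "flat_bounds (kern f (gam / 2) a sa) A (2 * (k2 * s)) (2 * (k2 * s + A))"
    by (rule flat_bounds_mono) (use Aa as k in \<open>auto intro: less_imp_le\<close>)
  from flat_bounds_cmult[OF this, of "mix_const e f gam a"] mix_const_pos[OF pos a0]
  show ?thesis by (simp add: scale_mix_def[abs_def] sa_def)
qed

section \<open>Continuity, boundedness and measurability in the exponent\<close>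

lemma not_nonpos_Int_if_pos: "x > 0 \<Longrightarrow> x \<notin> \<int>\<^sub>\<le>\<^sub>0" for x :: real
  using nonpos_Ints_nonpos[of x] by auto

lemma continuous_on_mix_const:
  assumes "e > 0" "f > 0" "gam > 0" "k1 > 0"
  shows "continuous_on {k1..k2} (mix_const e f gam)"
proof -
  have G: "continuous_on {k1..k2} (\<lambda>a. Gamma (c + 1 / a))" if "c \<ge> 0" for c :: real
  proof (rule continuous_on_compose2[of "{0<..}" Gamma])
    show "continuous_on {0<..} (Gamma :: real \<Rightarrow> real)"
      by (rule continuous_on_Gamma) (auto dest: not_nonpos_Int_if_pos)
    show "continuous_on {k1..k2} (\<lambda>a. c + 1 / a)"
      using assms by (intro continuous_intros) auto
    show "(\<lambda>a. c + 1 / a) ` {k1..k2} \<subseteq> {0<..}"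
      using assms that by (auto intro: add_nonneg_pos)
  qed
  have "Gamma (1 / a) \<noteq> 0" if "a \<in> {k1..k2}" for a :: real
  proof -
    have "1 / a > 0" using that assms by auto
    from Gamma_real_pos[OF this] show ?thesis by simp
  qed
  moreover have "Gamma e \<noteq> 0" using Gamma_real_pos[OF assms(1)] by simp
  ultimately show ?thesis
    unfolding mix_const_def[abs_def] using assms G[of 0] G[of e]
    by (intro continuous_intros) auto
qed

text \<open>The maximum over \<open>b\<close> is at 0, where the value is continuous in
  \<open>a\<close> on a compact interval.\<close>

lemma scale_mix_bounded:
  assumes "e > 0" "f > 0" "gam > 0" "k1 > 0"
  shows "\<exists>P. \<forall>a\<in>{k1..k2}. \<forall>b. scale_mix e f gam a b \<le> P"
proof -
  have "continuous_on {k1..k2} (\<lambda>a. mix_const e f gam a * f powr (- (e + 1 / a)))"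
    using assms by (intro continuous_intros continuous_on_mix_const) auto
  then have "compact ((\<lambda>a. mix_const e f gam a * f powr (- (e + 1 / a))) ` {k1..k2})"
    by (rule compact_continuous_image) simp
  then obtain P where P: "\<forall>x\<in>(\<lambda>a. mix_const e f gam a * f powr (- (e + 1 / a))) ` {k1..k2}. norm x \<le> P"
    using compact_imp_bounded bounded_iff by blast
  have "scale_mix e f gam a b \<le> P" if "a \<in> {k1..k2}" for a b
  proof -
    have "a > 0" using that assms by auto
    then have "scale_mix e f gam a b \<le> scale_mix e f gam a 0"
      using scale_mix_le assms by blast
    also have "\<dots> = mix_const e f gam a * f powr (- (e + 1 / a))"
      by (simp add: scale_mix_def kern_def)
    also have "\<dots> \<le> P"
      using bspec[OF P imageI[OF that]] by (simp only: real_norm_def abs_le_iff)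
    finally show ?thesis .
  qed
  then show ?thesis by blast
qed

lemma scale_mix_measurable_pair:
  assumes "e > 0" "f > 0" "gam > 0" "k1 > 0"
  shows "(\<lambda>(b, a). indicator {k1..k2} a * scale_mix e f gam a b) \<in> borel_measurable (borel \<Otimes>\<^sub>M borel)"
proof -
  \<comment> \<open>Continuity of the constant is known on \<open>{k1..k2}\<close> only, so its
    extension by 0 is what is shown Borel.\<close>
  have [measurable]: "(\<lambda>a. indicator {k1..k2} a *\<^sub>R mix_const e f gam a) \<in> borel_measurable borel"
    by (intro borel_measurable_continuous_on_indicator continuous_on_mix_const assms) auto
  have "(\<lambda>(b, a). (indicator {k1..k2} a *\<^sub>R mix_const e f gam a) * kern f (gam / 2) a (e + 1 / a) b)
      \<in> borel_measurable (borel \<Otimes>\<^sub>M borel)"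
    unfolding kern_def by measurable
  then show ?thesis by (simp add: scale_mix_def mult.assoc)
qed

section \<open>The hierarchical model: integrating out the exponent and the mixture label\<close>

locale hierarchical_model =
  fixes e1 f1 e2 f2 k1 k2 gam :: real
  assumes pos: "e1 > 0" "f1 > 0" "e2 > 0" "f2 > 0" "gam > 0" and k: "0 < k1" "k1 < k2"
begin

text \<open>Already contains both the weight 1/2 of \<kappa> and the uniform density of \<alpha>, so
  it is the joint density of \<alpha> and \<beta>, and \<open>prior\<close> is its plain integral
  over \<open>a\<close>.\<close>

definition cond_prior :: "real \<Rightarrow> real \<Rightarrow> real" where
  "cond_prior a b = 1 / (2 * (k2 - k1)) * (scale_mix e1 f1 gam a b + scale_mix e2 f2 gam a b)"

definition prior :: "real \<Rightarrow> real" where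
  "prior b = (LINT a:{k1..k2}|lborel. cond_prior a b)"

lemma cond_prior_pos: "a \<in> {k1..k2} \<Longrightarrow> cond_prior a b > 0"
  unfolding cond_prior_def using pos k by (intro mult_pos_pos add_pos_pos scale_mix_pos) auto

lemma cond_prior_bounded: "\<exists>P. \<forall>a\<in>{k1..k2}. \<forall>b. cond_prior a b \<le> P"
proof -
  obtain P1 where "\<forall>a\<in>{k1..k2}. \<forall>b. scale_mix e1 f1 gam a b \<le> P1"
    using scale_mix_bounded[OF pos(1,2,5) k(1)] by blast
  moreover obtain P2 where "\<forall>a\<in>{k1..k2}. \<forall>b. scale_mix e2 f2 gam a b \<le> P2"
    using scale_mix_bounded[OF pos(3,4,5) k(1)] by blast
  ultimately have "\<forall>a\<in>{k1..k2}. \<forall>b. cond_prior a b \<le> 1 / (2 * (k2 - k1)) * (P1 + P2)"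
    unfolding cond_prior_def using k by (intro ballI allI mult_left_mono add_mono) auto
  then show ?thesis by blast
qed

lemma cond_prior_measurable_pair [measurable]:
  "(\<lambda>(b, a). indicator {k1..k2} a * cond_prior a b) \<in> borel_measurable (borel \<Otimes>\<^sub>M borel)"
proof -
  note [measurable] = scale_mix_measurable_pair[OF pos(1,2,5) k(1), of k2]
    scale_mix_measurable_pair[OF pos(3,4,5) k(1), of k2]
  have "(\<lambda>x. 1 / (2 * (k2 - k1)) * ((case x of (b, a) \<Rightarrow> indicator {k1..k2} a * scale_mix e1 f1 gam a b)
      + (case x of (b, a) \<Rightarrow> indicator {k1..k2} a * scale_mix e2 f2 gam a b)))
      \<in> borel_measurable (borel \<Otimes>\<^sub>M borel)" by measurable
  then show ?thesis by (simp add: cond_prior_def case_prod_beta algebra_simps)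
qed

lemma cond_prior_set_integrable: "set_integrable lborel {k1..k2} (\<lambda>a. cond_prior a b)"
proof -
  obtain P where P: "\<And>a b. a \<in> {k1..k2} \<Longrightarrow> cond_prior a b \<le> P" using cond_prior_bounded by blast
  show ?thesis
    unfolding set_integrable_def real_scaleR_def
  proof (rule Bochner_Integration.integrable_bound)
    show "integrable lborel (\<lambda>a. indicator {k1..k2} a * P)"
      using k by (intro integrable_mult_left integrable_real_indicator) auto
    show "(\<lambda>a. indicator {k1..k2} a * cond_prior a b) \<in> borel_measurable lborel"
      using measurable_compose[OF measurable_Pair1' cond_prior_measurable_pair, of b] by simp
    show "AE a in lborel. norm (indicator {k1..k2} a * cond_prior a b) \<le> norm (indicator {k1..k2} a * P)"
    proof (rule AE_I2)
      fix a
      show "norm (indicator {k1..k2} a * cond_prior a b) \<le> norm (indicator {k1..k2} a * P)"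
        using P[of a b] cond_prior_pos[of a b] by (cases "a \<in> {k1..k2}") auto
    qed
  qed
qed

lemma prior_measurable [measurable]: "prior \<in> borel_measurable borel"
proof -
  have "(\<lambda>b. LINT a|lborel. (case (b, a) of (b, a) \<Rightarrow> indicator {k1..k2} a * cond_prior a b)) \<in> borel_measurable borel"
    by (rule lborel.borel_measurable_lebesgue_integral)
      (use cond_prior_measurable_pair in
        \<open>simp add: measurable_cong_sets[OF sets_pair_measure_cong[OF refl sets_lborel] refl]\<close>)
  then show ?thesis by (simp add: prior_def[abs_def] set_lebesgue_integral_def)
qed

text \<open>A positive integrand with integral 0 would make the interval \<open>{k1..k2}\<close> a
  null set, but its length is positive.\<close>

lemma prior_pos: "prior b > 0"
proof -
  have nn: "0 \<le> indicator {k1..k2} a *\<^sub>R cond_prior a b" for a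
    using cond_prior_pos[of a b] by (cases "a \<in> {k1..k2}") auto
  have "prior b \<noteq> 0"
  proof
    assume "prior b = 0"
    then have "AE a in lborel. indicator {k1..k2} a *\<^sub>R cond_prior a b = 0"
      using integral_nonneg_eq_0_iff_AE[OF cond_prior_set_integrable[unfolded set_integrable_def, of b]] nn
      by (simp add: prior_def set_lebesgue_integral_def)
    then have "AE a in lborel. a \<notin> {k1..k2}"
    proof eventually_elim
      case (elim a)
      then show ?case using cond_prior_pos[of a b] by (cases "a \<in> {k1..k2}") auto
    qed
    then have "emeasure lborel {k1..k2} = 0"
      by (subst (asm) AE_iff_measurable[of "{k1..k2}"]) auto
    then show False using k by simp
  qed
  moreover have "prior b \<ge> 0"
    unfolding prior_def set_lebesgue_integral_def using nn by (intro integral_nonneg_AE) auto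
  ultimately show ?thesis by simp
qed

lemma prior_bounded: "\<exists>P. \<forall>b. prior b \<le> P"
proof -
  obtain P where P: "\<And>a b. a \<in> {k1..k2} \<Longrightarrow> cond_prior a b \<le> P" using cond_prior_bounded by blast
  have "prior b \<le> (LINT a:{k1..k2}|lborel. P)" for b
    unfolding prior_def using P k
    by (intro set_integral_mono cond_prior_set_integrable)
      (auto simp: set_integrable_def intro!: integrable_mult_left)
  then show ?thesis by blast
qed

lemma prior_flat_bounds: "\<exists>B S W. flat_bounds prior B S W"
proof -
  define s1 s2 where "s1 = e1 + 1 / k1" and "s2 = e2 + 1 / k1"
  define A1 A2 where "A1 = (1 + gam / 2 / f1) powr s1" and "A2 = (1 + gam / 2 / f2) powr s2"
  \<comment> \<open>Sums of nonnegative constants dominate those of each component, giving one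
    triple for both.\<close>
  define B S W where "B = A1 + A2" and "S = 2 * (k2 * s1) + 2 * (k2 * s2)"
    and "W = 2 * (k2 * s1 + A1) + 2 * (k2 * s2 + A2)"
  have nn: "A1 \<ge> 0" "A2 \<ge> 0" "k2 * s1 \<ge> 0" "k2 * s2 \<ge> 0"
    using pos k by (auto simp: A1_def A2_def s1_def s2_def)
  have "flat_bounds (cond_prior a) B S W" if a: "a \<in> {k1..k2}" for a
  proof -
    have a': "k1 \<le> a" "a \<le> k2" "a > 0" using a k by auto
    have "flat_bounds (scale_mix e1 f1 gam a) B S W"
      using scale_mix_flat_bounds[OF pos(1,2,5) k(1) a'(1,2)]
      by (rule flat_bounds_mono)
        (use nn less_imp_le[OF scale_mix_pos[OF pos(1,2,5) a'(3)]] in \<open>auto simp: B_def S_def W_def A1_def s1_def\<close>)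
    moreover have "flat_bounds (scale_mix e2 f2 gam a) B S W"
      using scale_mix_flat_bounds[OF pos(3,4,5) k(1) a'(1,2)]
      by (rule flat_bounds_mono)
        (use nn less_imp_le[OF scale_mix_pos[OF pos(3,4,5) a'(3)]] in \<open>auto simp: B_def S_def W_def A2_def s2_def\<close>)
    ultimately show ?thesis
      unfolding cond_prior_def[abs_def] using k by (intro flat_bounds_cmult flat_bounds_add) auto
  qed
  then have "flat_bounds prior B S W"
    unfolding prior_def[abs_def] by (intro flat_bounds_set_integral cond_prior_set_integrable)
  then show ?thesis by blast
qed

text \<open>Fubini again: positivity of \<open>cond_prior\<close> makes the integral of the absolute
  value over \<open>a\<close> equal to \<open>\<bar>G b\<bar> * prior b\<close>, dominated by a
  multiple of \<open>\<bar>G b\<bar>\<close> as \<open>prior\<close> is bounded.\<close>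

lemma integral_over_exponent_swap:
  assumes G: "integrable lborel G"
  shows "(LINT a:{k1..k2}|lborel. LINT b|lborel. G b * cond_prior a b) = (LINT b|lborel. G b * prior b)"
proof -
  have Gm [measurable]: "G \<in> borel_measurable borel" using borel_measurable_integrable[OF G] by simp
  define F where "F b a = G b * (indicator {k1..k2} a * cond_prior a b)" for b a
  have "(\<lambda>x. G (fst x) * (case x of (b, a) \<Rightarrow> indicator {k1..k2} a * cond_prior a b))
      \<in> borel_measurable (borel \<Otimes>\<^sub>M borel)" by measurable
  then have Fm: "case_prod F \<in> borel_measurable (lborel \<Otimes>\<^sub>M lborel)"
    by (simp add: F_def[abs_def] case_prod_beta' measurable_cong_sets[OF sets_pair_measure_cong[OF sets_lborel sets_lborel] refl])
  have inner: "(LINT a|lborel. indicator {k1..k2} a * cond_prior a b) = prior b" for b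
    by (simp add: prior_def set_lebesgue_integral_def)
  have norm: "\<bar>F b a\<bar> = \<bar>G b\<bar> * (indicator {k1..k2} a * cond_prior a b)" for b a
    using cond_prior_pos[of a b] by (cases "a \<in> {k1..k2}") (auto simp: F_def abs_mult)
  obtain P where P: "\<And>b. prior b \<le> P" using prior_bounded by blast
  have "integrable (lborel \<Otimes>\<^sub>M lborel) (case_prod F)"
  proof (rule lborel_pair.Fubini_integrable[OF Fm])
    have "integrable lborel (\<lambda>b. \<bar>G b\<bar> * prior b)"
    proof (rule Bochner_Integration.integrable_bound)
      show "integrable lborel (\<lambda>b. \<bar>G b\<bar> * P)" using G by simp
      show "AE b in lborel. norm (\<bar>G b\<bar> * prior b) \<le> norm (\<bar>G b\<bar> * P)"
      proof (rule AE_I2)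
        fix b
        have "\<bar>prior b\<bar> \<le> \<bar>P\<bar>" using P[of b] prior_pos[of b] by linarith
        then show "norm (\<bar>G b\<bar> * prior b) \<le> norm (\<bar>G b\<bar> * P)" by (simp add: abs_mult mult_left_mono)
      qed
    qed simp
    then show "integrable lborel (\<lambda>x. LINT y|lborel. norm (case (x, y) of (x, xa) \<Rightarrow> F x xa))"
      by (simp add: norm inner)
    show "AE x in lborel. integrable lborel (\<lambda>y. case (x, y) of (x, xa) \<Rightarrow> F x xa)"
      using cond_prior_set_integrable by (simp add: F_def set_integrable_def)
  qed
  from lborel_pair.Fubini_integral[OF this]
  have "(LINT a|lborel. LINT b|lborel. F b a) = (LINT b|lborel. LINT a|lborel. F b a)" .
  also have "(LINT b|lborel. LINT a|lborel. F b a) = (LINT b|lborel. G b * prior b)"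
    by (simp add: F_def inner)
  also have "(LINT a|lborel. LINT b|lborel. F b a)
      = (LINT a:{k1..k2}|lborel. LINT b|lborel. G b * cond_prior a b)"
  proof -
    have "F b a = indicator {k1..k2} a * (G b * cond_prior a b)" for b a by (simp add: F_def mult_ac)
    then show ?thesis by (simp add: set_lebesgue_integral_def)
  qed
  finally show ?thesis .
qed

text \<open>Two exchanges bring the \<beta> integral outermost, first past \<lambda> in each Gamma
  component, then past \<alpha>. The case \<open>g = 1\<close> yields the marginal,
  \<open>g b = b\<close> the numerator of the posterior mean.\<close>

lemma hier_integral_eq:
  assumes G: "integrable lborel (\<lambda>b. g b * normal1_density b y)"
  shows "hier_integral g e1 f1 e2 f2 k1 k2 gam y = (LINT b|lborel. g b * normal1_density b y * prior b)"
proof -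
  have "hier_integral g e1 f1 e2 f2 k1 k2 gam y
      = (LINT a:{k1..k2}|lborel. LINT b|lborel. g b * normal1_density b y * cond_prior a b)"
    unfolding hier_integral_def
  proof (rule set_lebesgue_integral_cong, simp, intro allI impI)
    fix a assume "a \<in> {k1..k2}"
    then have a: "a > 0" using k by auto
    note i1 = integrable_times_scale_mix[OF pos(1,2,5) a G]
      and i2 = integrable_times_scale_mix[OF pos(3,4,5) a G]
    have "g b * normal1_density b y * cond_prior a b = 1 / (2 * (k2 - k1)) *
        (g b * normal1_density b y * scale_mix e1 f1 gam a b
          + g b * normal1_density b y * scale_mix e2 f2 gam a b)" for b
      by (simp add: cond_prior_def distrib_left)
    then have "(LINT b|lborel. g b * normal1_density b y * cond_prior a b) =
      (LINT b|lborel. 1 / (2 * (k2 - k1)) * (g b * normal1_density b y * scale_mix e1 f1 gam a b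
         + g b * normal1_density b y * scale_mix e2 f2 gam a b))"
      by (simp only:)
    also have "\<dots> = 1 / (2 * (k2 - k1)) * ((LINT b|lborel. g b * normal1_density b y * scale_mix e1 f1 gam a b)
         + (LINT b|lborel. g b * normal1_density b y * scale_mix e2 f2 gam a b))"
      by (subst integral_mult_right_zero) (simp only: Bochner_Integration.integral_add[OF i1 i2])
    \<comment> \<open>The value 0 of \<kappa> selects the first Gamma component and the value 1 the
      second.\<close>
    finally show "(1 / (k2 - k1)) * (\<Sum>\<kappa>\<in>{0::real, 1}. (1 / 2) *
           (LINT l:{0<..}|lborel. lambda_prior e1 f1 e2 f2 \<kappa> l *
              (LINT b|lborel. g b * normal1_density b y * gg_prior gam l a b)))
        = (LINT b|lborel. g b * normal1_density b y * cond_prior a b)"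
      using integral_gamma_gg_swap[OF pos(1,2,5) a G] integral_gamma_gg_swap[OF pos(3,4,5) a G]
      by (simp add: lambda_prior_def distrib_left mult.commute[of _ 2])
  qed
  also have "\<dots> = (LINT b|lborel. g b * normal1_density b y * prior b)"
    by (rule integral_over_exponent_swap[OF G])
  finally show ?thesis .
qed

end

section \<open>Posterior mean and logarithmic derivative as one quotient\<close>

theorem theorem1:
  fixes e1 f1 e2 f2 k1 k2 gam :: real
  assumes "e1 > 0" "f1 > 0" "e2 > 0" "f2 > 0"
    and "0 < k1" "k1 \<le> 1" "2 \<le> k2" and "gam > 0"
  shows "(\<exists>C. \<forall>y. \<bar>y - post_mean e1 f1 e2 f2 k1 k2 gam y\<bar> \<le> C)
       \<and> ((\<lambda>y. deriv (\<lambda>t. ln (marginal e1 f1 e2 f2 k1 k2 gam t)) y) \<longlongrightarrow> 0) at_infinity"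
proof -
  interpret hierarchical_model e1 f1 e2 f2 k1 k2 gam
    using assms by unfold_locales auto
  obtain B S W where "flat_bounds prior B S W" using prior_flat_bounds by blast
  then interpret flat_tailed prior B S W
    by unfold_locales (auto intro: prior_pos)
  have marg: "marginal e1 f1 e2 f2 k1 k2 gam y = conv y" for y
  proof -
    have "integrable lborel (\<lambda>b. 1 * normal1_density b y)"
      using lborel_integrable_real_affine[OF integrable_normal_density[of 1 0], of "- 1" y]
      by (simp add: normal1_density_eq)
    from hier_integral_eq[OF this] show ?thesis
      by (simp add: marginal_def conv_def normal1_density_eq)
  qed
  \<comment> \<open>Tweedie's formula: writing \<open>b = (b - y) + y\<close> splits the numerator
    of the posterior mean into \<open>conv_deriv y\<close> and \<open>y * conv y\<close>.\<close>
  have mean: "hier_integral (\<lambda>b. b) e1 f1 e2 f2 k1 k2 gam y = conv_deriv y + y * conv y" for y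
  proof -
    have "integrable lborel (\<lambda>x. std_normal_density x * (y - x))"
      using integrable_std_normal_moment[of 1] by (simp add: right_diff_distrib)
    from lborel_integrable_real_affine[OF this, of "- 1" y]
    have "integrable lborel (\<lambda>b. b * normal1_density b y)"
      by (simp add: normal1_density_eq mult.commute)
    from hier_integral_eq[OF this]
    have "hier_integral (\<lambda>b. b) e1 f1 e2 f2 k1 k2 gam y
        = (LINT b|lborel. (b - y) * std_normal_density (y - b) * prior b + y * (std_normal_density (y - b) * prior b))"
      by (simp add: normal1_density_eq algebra_simps)
    also have "\<dots> = conv_deriv y + y * conv y"
      unfolding conv_def conv_deriv_def
      using Bochner_Integration.integral_add[OF integrable_conv_deriv
          integrable_mult_right[OF integrable_conv, of y], of y] by simp
    finally show ?thesis .
  qed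
  \<comment> \<open>The shrinkage is minus the logarithmic derivative of the marginal, so both
    claims concern \<open>conv_deriv y / conv y\<close>.\<close>
  have "\<bar>y - post_mean e1 f1 e2 f2 k1 k2 gam y\<bar> = \<bar>conv_deriv y / conv y\<bar>" for y
    using conv_pos[of y] by (simp add: post_mean_def marg mean add_divide_distrib)
  with log_deriv_bounded log_deriv_tendsto_0 show ?thesis
    by (simp add: marg deriv_ln_conv)
qed

end
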